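(* Fix $1 \le p < 2$. There is a constant $c_p > 0$ depending only on $p$ such that the following holds for all integers $n \ge d \ge 1$ and $r \ge 2$. If a distribution over $r \times n$ real matrices $\Pi$ is an $\ell_p$ oblivious subspace embedding for $n\times d$ matrices with distortion $\kappa$, then $$\kappa \;\ge\; \frac{c_p}{\left(\frac{1}{d}\right)^{1/p}\log^{2/p} r \;+\; \left(\frac{r}{n}\right)^{1/p-1/2}}.$$
   Context: For $y\in\mathbb{R}^n$, $\|y\|_p=(\sum_i |y_i|^p)^{1/p}$. A distribution over $r\times n$ real matrices $\Pi$ is an $\ell_p$ oblivious subspace embedding (for $n\times d$ matrices) with distortion $\kappa \ge 1$ if for every fixed $A\in\mathbb{R}^{n\times d}$, $$\Pr_{\Pi}\big[\ \|Ax\|_p \le \|\Pi A x\|_p \le \kappa\|Ax\|_p \text{ for all } x\in\mathbb{R}^d\ \big] \ge 0.99.$$ The distribution may depend on $n,d,r$ but not on $A$. *)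

theory Defs
  imports "HOL-Probability.Probability"
begin

text \<open>Vectors in R^m are functions nat => real, only coordinates < m matter.
  An a x b matrix is a function nat * nat => real, only entries (i,j) with
  i < a, j < b matter.\<close>

definition lp_norm :: "real \<Rightarrow> nat \<Rightarrow> (nat \<Rightarrow> real) \<Rightarrow> real" where
  "lp_norm p m y = (\<Sum>i<m. \<bar>y i\<bar> powr p) powr (1 / p)"

definition mat_vec :: "nat \<Rightarrow> (nat \<times> nat \<Rightarrow> real) \<Rightarrow> (nat \<Rightarrow> real) \<Rightarrow> (nat \<Rightarrow> real)" where
  "mat_vec k M x = (\<lambda>i. \<Sum>j<k. M (i, j) * x j)"

definition matrix_space :: "nat \<Rightarrow> nat \<Rightarrow> (nat \<times> nat \<Rightarrow> real) measure" where
  "matrix_space r n = PiM ({..<r} \<times> {..<n}) (\<lambda>_. borel)"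

definition lp_OSE :: "real \<Rightarrow> nat \<Rightarrow> nat \<Rightarrow> nat \<Rightarrow> real \<Rightarrow> (nat \<times> nat \<Rightarrow> real) measure \<Rightarrow> bool" where
  "lp_OSE p n d r \<kappa> D \<longleftrightarrow>
     prob_space D \<and> sets D = sets (matrix_space r n) \<and> \<kappa> \<ge> 1 \<and>
     (\<forall>A :: nat \<times> nat \<Rightarrow> real.
        measure D {P \<in> space D. \<forall>x :: nat \<Rightarrow> real.
            lp_norm p n (mat_vec d A x) \<le> lp_norm p r (mat_vec n P (mat_vec d A x)) \<and>
            lp_norm p r (mat_vec n P (mat_vec d A x)) \<le> \<kappa> * lp_norm p n (mat_vec d A x)}
        \<ge> 0.99)"

end

theory Submission
  imports Defs
begin

text \<open>By averaging over matrices with \<open>d\<close> independent random columns there is one matrix \<open>P\<close> that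
  respects a random vector up to a failure probability \<open>O(1/d)\<close>. Mixing \<open>t + 1\<close> distributions, \<open>P\<close>
  fails with probability \<open>O(t/d)\<close> on each of them.

  Let \<open>2 ^ t \<le> n\<close>. At scale \<open>k \<le> t\<close> the random vector has one random sign in a random position of each
  of \<open>2 ^ k\<close> blocks of length \<open>2 ^ (t - k)\<close>. If it meets a column of \<open>P\<close> whose \<open>p\<close>-norm to the power \<open>p\<close>
  exceeds \<open>\<kappa> powr p * 2 ^ k\<close>, then the upper bound fails with probability at least one half; hence there
  are only \<open>O(2 ^ (t - k) * t / d)\<close> such columns. Summing over \<open>k\<close>, the columns of norm above \<open>\<kappa>\<close>
  contribute \<open>O(\<kappa> powr p * 2 ^ t * t\<^sup>2 / d)\<close> to the expected \<open>p\<close>-th power of the norm of the image of a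
  random sign vector; the others contribute at most \<open>\<kappa> powr p * 2 ^ t * (r / 2 ^ t) powr (1 - p / 2)\<close>
  by a second moment bound and concavity. The lower bound of the embedding makes the total at least a
  constant times \<open>2 ^ t\<close>. Since an embedding has \<open>d \<le> r\<close>, taking \<open>2 ^ t\<close> to be the smaller of \<open>n\<close> and a
  fixed power of \<open>r\<close> gives the claim.\<close>

section \<open>Power inequalities for real numbers\<close>

text \<open>Jensen's inequality for the concave power \<open>\<theta>\<close>: Young's inequality
  supplies the tangent line at the mean \<open>X\<close>, and summing it collapses the linear terms
  to \<open>card A * X\<close>.\<close>

lemma sum_powr_le_card:
  fixes x :: "'a \<Rightarrow> real"
  assumes "finite A" "\<And>i. i \<in> A \<Longrightarrow> 0 \<le> x i" "0 < \<theta>" "\<theta> \<le> 1"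
  shows "(\<Sum>i\<in>A. x i powr \<theta>) \<le> real (card A) powr (1 - \<theta>) * (\<Sum>i\<in>A. x i) powr \<theta>"
proof (cases "(\<Sum>i\<in>A. x i) = 0")
  case True
  then have "x i = 0" if "i \<in> A" for i
    using assms that by (metis sum_nonneg_eq_0_iff)
  then show ?thesis by simp
next
  case False
  define X where "X = (\<Sum>i\<in>A. x i) / card A"
  have "(\<Sum>i\<in>A. x i) > 0"
    using False assms(2) by (metis less_eq_real_def sum_nonneg)
  moreover have c: "card A > 0"
    using False assms(1) by (auto simp: card_gt_0_iff)
  ultimately have X: "X > 0" by (simp add: X_def)
  have "x i powr \<theta> * X powr (1 - \<theta>) \<le> \<theta> * x i + (1 - \<theta>) * X" if "i \<in> A" for i
    using Youngs_inequality_0[of \<theta> "1 - \<theta>" "x i" X] assms that X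
    by (cases "x i = 0") (auto simp: less_le)
  then have "(\<Sum>i\<in>A. x i powr \<theta> * X powr (1 - \<theta>)) \<le> (\<Sum>i\<in>A. \<theta> * x i + (1 - \<theta>) * X)"
    by (rule sum_mono)
  also have "\<dots> = card A * X"
  proof -
    have "(\<Sum>i\<in>A. x i) = card A * X"
      using c by (simp add: X_def)
    moreover have "(\<Sum>i\<in>A. \<theta> * x i + (1 - \<theta>) * X)
        = \<theta> * (\<Sum>i\<in>A. x i) + card A * ((1 - \<theta>) * X)"
      by (simp add: sum.distrib sum_distrib_left)
    ultimately show ?thesis by (simp add: algebra_simps)
  qed
  finally have "(\<Sum>i\<in>A. x i powr \<theta>) * X powr (1 - \<theta>) \<le> card A * (X powr \<theta> * X powr (1 - \<theta>))"
    using X by (simp add: sum_distrib_right powr_add[symmetric])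
  then have "(\<Sum>i\<in>A. x i powr \<theta>) \<le> card A * X powr \<theta>"
    using X by simp
  also have "\<dots> = real (card A) powr (1 - \<theta>) * (\<Sum>i\<in>A. x i) powr \<theta>"
    using c \<open>(\<Sum>i\<in>A. x i) > 0\<close> by (simp add: X_def powr_divide powr_diff)
  finally show ?thesis .
qed

text \<open>Convexity of the \<open>p\<close>-th power, read off from concavity at exponent
  \<open>1 / p\<close> for two terms.\<close>

lemma powr_midpoint:
  fixes a b p :: real
  assumes "1 \<le> p"
  shows "\<bar>(a + b) / 2\<bar> powr p \<le> (\<bar>a\<bar> powr p + \<bar>b\<bar> powr p) / 2"
proof -
  have "(\<Sum>i\<in>{0, 1::nat}. (if i = 0 then \<bar>a\<bar> powr p else \<bar>b\<bar> powr p) powr (1 / p))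
      \<le> real (card {0, 1::nat}) powr (1 - 1 / p) *
        (\<Sum>i\<in>{0, 1::nat}. if i = 0 then \<bar>a\<bar> powr p else \<bar>b\<bar> powr p) powr (1 / p)"
    using assms by (intro sum_powr_le_card) auto
  then have "\<bar>a\<bar> + \<bar>b\<bar> \<le> 2 powr (1 - 1 / p) * (\<bar>a\<bar> powr p + \<bar>b\<bar> powr p) powr (1 / p)"
    using assms by (simp add: powr_powr)
  then have "\<bar>(a + b) / 2\<bar> \<le> 2 powr (1 - 1 / p) * (\<bar>a\<bar> powr p + \<bar>b\<bar> powr p) powr (1 / p) / 2"
    by (simp add: abs_triangle_ineq[THEN order_trans])
  then have "\<bar>(a + b) / 2\<bar> powr p
      \<le> (2 powr (1 - 1 / p) * (\<bar>a\<bar> powr p + \<bar>b\<bar> powr p) powr (1 / p) / 2) powr p"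
    using assms by (intro powr_mono2) auto
  also have "\<dots> = 2 powr ((1 - 1 / p) * p) * (\<bar>a\<bar> powr p + \<bar>b\<bar> powr p) / 2 powr p"
    using assms by (simp add: powr_mult powr_divide powr_powr)
  also have "(1 - 1 / p) * p = p - 1"
    using assms by (simp add: field_simps)
  finally show ?thesis by (simp add: powr_diff)
qed

text \<open>After division by \<open>a + b\<close> both summands lie between 0 and 1, where an
  exponent of at most 1 can only enlarge them.\<close>

lemma powr_add_subadditive:
  fixes a b \<theta> :: real
  assumes "0 \<le> a" "0 \<le> b" "0 < \<theta>" "\<theta> \<le> 1"
  shows "(a + b) powr \<theta> \<le> a powr \<theta> + b powr \<theta>"
proof (cases "a + b = 0")
  case False
  then have pos: "a + b > 0" using assms by simp
  have "x / (a + b) \<le> (x / (a + b)) powr \<theta>" if "0 \<le> x" "x \<le> a + b" for x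
    using powr_mono'[of \<theta> 1 "x / (a + b)"] assms that pos by (simp add: powr_one)
  from this[of a] this[of b] have "a / (a + b) + b / (a + b) \<le> (a / (a + b)) powr \<theta> + (b / (a + b)) powr \<theta>"
    using assms by simp
  also have "a / (a + b) + b / (a + b) = 1"
    using pos by (simp add: add_divide_distrib[symmetric])
  finally show ?thesis
    using pos assms by (simp add: powr_divide field_simps)
qed (use assms in simp)

lemma sum_powr_subadditive:
  fixes x :: "'a \<Rightarrow> real"
  assumes "finite A" "\<And>i. i \<in> A \<Longrightarrow> 0 \<le> x i" "0 < \<theta>" "\<theta> \<le> 1"
  shows "(\<Sum>i\<in>A. x i) powr \<theta> \<le> (\<Sum>i\<in>A. x i powr \<theta>)"
  using assms
proof (induction A rule: finite_induct)
  case (insert a A)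
  have "(\<Sum>i\<in>insert a A. x i) powr \<theta> = (x a + (\<Sum>i\<in>A. x i)) powr \<theta>"
    using insert by simp
  also have "\<dots> \<le> x a powr \<theta> + (\<Sum>i\<in>A. x i) powr \<theta>"
    using insert by (intro powr_add_subadditive sum_nonneg) auto
  finally show ?case using insert by force
qed simp

lemma abs_powr_eq_square_powr: "\<bar>x::real\<bar> powr p = (x\<^sup>2) powr (p / 2)"
proof -
  have "\<bar>x\<bar> powr p = (\<bar>x\<bar> powr 2) powr (p / 2)" by (simp only: powr_powr) simp
  then show ?thesis by (simp add: powr_numeral del: powr_powr)
qed

text \<open>The largest \<open>k\<close> with \<open>2 ^ k < x\<close> contributes
  \<open>2 ^ (k + 1)\<close>, which already dominates \<open>x\<close>. Later this turns counts of
  heavy columns at each scale into a bound on their total size.\<close>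

lemma dyadic_layer_cake:
  fixes x :: real
  assumes "x \<le> 2 ^ t"
  shows "x \<le> 1 \<or> x \<le> (\<Sum>k<t. if 2 ^ k < x then 2 ^ (k + 1) else 0)"
  using assms
proof (induction t)
  case (Suc t)
  have "(0::real) \<le> (\<Sum>k<t. if 2 ^ k < x then 2 ^ (k + 1) else 0)"
    by (intro sum_nonneg) auto
  then show ?case using Suc by (cases "x \<le> 2 ^ t") auto
qed simp

section \<open>The embedding property at a single vector\<close>

text \<open>The \<open>p\<close>-th power of the norm is additive over coordinates, so sums over
  coordinates, columns and sign patterns can be exchanged.\<close>

definition npow :: "real \<Rightarrow> nat \<Rightarrow> (nat \<Rightarrow> real) \<Rightarrow> real" where
  "npow p m y = (\<Sum>i<m. \<bar>y i\<bar> powr p)"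

lemma npow_nonneg: "0 \<le> npow p m y"
  by (simp add: npow_def sum_nonneg)

definition good :: "real \<Rightarrow> nat \<Rightarrow> nat \<Rightarrow> real \<Rightarrow> (nat \<times> nat \<Rightarrow> real) \<Rightarrow> (nat \<Rightarrow> real) \<Rightarrow> bool" where
  "good p n r \<kappa> P v \<longleftrightarrow> npow p n v \<le> npow p r (mat_vec n P v) \<and>
     npow p r (mat_vec n P v) \<le> \<kappa> powr p * npow p n v"

lemma good_iff_lp_norm:
  assumes "1 \<le> p" "0 < \<kappa>"
  shows "good p n r \<kappa> P v \<longleftrightarrow> lp_norm p n v \<le> lp_norm p r (mat_vec n P v) \<and>
     lp_norm p r (mat_vec n P v) \<le> \<kappa> * lp_norm p n v"
proof -
  have le: "a powr (1 / p) \<le> b powr (1 / p) \<longleftrightarrow> a \<le> b" if "0 \<le> a" "0 \<le> b" for a b :: real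
    using that assms by (metis divide_nonneg_nonneg less_eq_real_def not_less powr_less_mono2 powr_mono2 zero_less_divide_iff zero_less_one less_le_trans)
  have "\<kappa> * lp_norm p n v = (\<kappa> powr p * npow p n v) powr (1 / p)"
    using assms by (simp add: lp_norm_def npow_def powr_mult powr_powr)
  then show ?thesis
    by (simp add: good_def lp_norm_def npow_def[symmetric] le npow_nonneg)
qed

section \<open>An embedding cannot lower the dimension\<close>

text \<open>Gaussian elimination, one row at a time: a row vanishing on \<open>J\<close> is dropped;
  otherwise a pivot \<open>k\<close> removes one unknown together with one equation.\<close>

lemma kernel_nontrivial:
  fixes M :: "nat \<times> nat \<Rightarrow> real"
  assumes "finite J" "r < card J"
  shows "\<exists>x. (\<exists>j\<in>J. x j \<noteq> 0) \<and> (\<forall>j. j \<notin> J \<longrightarrow> x j = 0) \<and> (\<forall>i<r. (\<Sum>j\<in>J. M (i, j) * x j) = 0)"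
  using assms
proof (induction r arbitrary: J M)
  case 0
  then have "J \<noteq> {}" by auto
  then show ?case by (intro exI[of _ "\<lambda>j. if j \<in> J then 1 else 0"]) auto
next
  case (Suc r)
  show ?case
  proof (cases "\<forall>j\<in>J. M (r, j) = 0")
    case True
    obtain x where "\<exists>j\<in>J. x j \<noteq> 0" "\<forall>j. j \<notin> J \<longrightarrow> x j = 0" "\<forall>i<r. (\<Sum>j\<in>J. M (i, j) * x j) = 0"
      using Suc.IH[of J M] Suc.prems by auto
    with True show ?thesis by (intro exI[of _ x]) (auto simp: less_Suc_eq)
  next
    case False
    then obtain k where k: "k \<in> J" "M (r, k) \<noteq> 0" by auto
    define M' where "M' = (\<lambda>(i, j). M (i, j) - M (i, k) * M (r, j) / M (r, k))"
    have "finite (J - {k})" "r < card (J - {k})"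
      using Suc.prems k by auto
    from Suc.IH[OF this, of M'] obtain x where
      x: "\<exists>j\<in>J - {k}. x j \<noteq> 0" "\<forall>j. j \<notin> J - {k} \<longrightarrow> x j = 0"
         "\<forall>i<r. (\<Sum>j\<in>J - {k}. M' (i, j) * x j) = 0"
      by auto
    \<comment> \<open>Back substitution: \<open>c\<close> is the value of the unknown
      \<open>k\<close> that row \<open>r\<close> forces. The other rows then hold because
      \<open>M'\<close> is what remains of them after eliminating that unknown.\<close>
    define c where "c = - (\<Sum>j\<in>J - {k}. M (r, j) * x j) / M (r, k)"
    have split: "(\<Sum>j\<in>J. M (i, j) * (x(k := c)) j) = M (i, k) * c + (\<Sum>j\<in>J - {k}. M (i, j) * x j)" for i
      using k Suc.prems by (subst sum.remove[of J k]) (auto intro!: sum.cong)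
    have "(\<Sum>j\<in>J - {k}. M' (i, j) * x j)
        = (\<Sum>j\<in>J - {k}. M (i, j) * x j) + M (i, k) * c" for i
      by (simp add: M'_def c_def left_diff_distrib sum_subtractf sum_distrib_left sum_divide_distrib
          algebra_simps)
    with x(3) have "(\<Sum>j\<in>J. M (i, j) * (x(k := c)) j) = 0" if "i < Suc r" for i
      using that k unfolding split by (cases "i = r") (auto simp: c_def add.commute less_Suc_eq)
    with x k show ?thesis by (intro exI[of _ "x(k := c)"]) auto
  qed
qed

text \<open>Take \<open>A\<close> to be the inclusion of the first \<open>d\<close> coordinates. If
  \<open>r < d\<close>, every \<open>P\<close> kills a nonzero vector supported there, against the
  lower bound of the embedding.\<close>

lemma lp_OSE_dim_le:
  assumes "lp_OSE p n d r \<kappa> D" "1 \<le> p" "d \<le> n"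
  shows "d \<le> r"
proof (rule ccontr)
  assume "\<not> d \<le> r"
  define A :: "nat \<times> nat \<Rightarrow> real" where "A = (\<lambda>(i, j). if i = j then 1 else 0)"
  let ?G = "{P \<in> space D. \<forall>x. lp_norm p n (mat_vec d A x) \<le> lp_norm p r (mat_vec n P (mat_vec d A x)) \<and>
        lp_norm p r (mat_vec n P (mat_vec d A x)) \<le> \<kappa> * lp_norm p n (mat_vec d A x)}"
  have "measure D ?G \<ge> 0.99" and \<kappa>: "\<kappa> \<ge> 1"
    using assms unfolding lp_OSE_def by blast+
  have "?G \<noteq> {}"
  proof
    assume "?G = {}"
    with \<open>measure D ?G \<ge> 0.99\<close> show False by (simp only: measure_empty) simp
  qed
  then obtain P where P: "\<And>x. good p n r \<kappa> P (mat_vec d A x)"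
    using good_iff_lp_norm[of p \<kappa>] assms(2) \<kappa> by auto
  obtain x where x: "\<exists>j\<in>{..<d}. x j \<noteq> 0" "\<forall>j. j \<notin> {..<d} \<longrightarrow> x j = 0"
    "\<forall>i<r. (\<Sum>j\<in>{..<d}. P (i, j) * x j) = 0"
    using kernel_nontrivial[of "{..<d}" r P] \<open>\<not> d \<le> r\<close> by auto
  have Ax: "mat_vec d A x = x"
  proof
    fix i
    have "mat_vec d A x i = (\<Sum>j<d. if j = i then x j else 0)"
      unfolding mat_vec_def A_def by (intro sum.cong) auto
    also have "\<dots> = x i" using x(2) by (auto simp: sum.delta)
    finally show "mat_vec d A x i = x i" .
  qed
  have "mat_vec n P x i = 0" if "i < r" for i
  proof -
    have "mat_vec n P x i = (\<Sum>j<d. P (i, j) * x j)"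
      unfolding mat_vec_def using x(2) assms(3) by (intro sum.mono_neutral_right) auto
    then show ?thesis using x(3) that by simp
  qed
  then have "npow p r (mat_vec n P x) = 0" by (simp add: npow_def)
  with P[of x] have "npow p n x \<le> 0" by (simp add: Ax good_def)
  moreover obtain j where "j < d" "x j \<noteq> 0" using x(1) by auto
  moreover from this have "\<bar>x j\<bar> powr p \<le> npow p n x"
    using assms(3) unfolding npow_def by (intro member_le_sum) auto
  ultimately have "\<bar>x j\<bar> powr p \<le> 0" by linarith
  with \<open>x j \<noteq> 0\<close> show False by simp
qed

section \<open>One matrix for many random vectors\<close>

text \<open>If a fixed \<open>P\<close> fails on a random vector with probability \<open>b\<close>,
  it succeeds on \<open>d\<close> independent copies with probability \<open>(1 - b) ^ d\<close>.
  With the copies as columns of \<open>A\<close>, averaging over \<open>A\<close> yields a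
  \<open>P\<close> for which this is at least 0.99, which forces \<open>b\<close> down to order
  \<open>1 / d\<close>.\<close>

lemma lp_OSE_random_vector:
  fixes \<mu> :: "'x \<Rightarrow> real" and v :: "'x \<Rightarrow> nat \<Rightarrow> real"
  assumes ose: "lp_OSE p n d r \<kappa> D" and p: "1 \<le> p" and d: "1 \<le> d"
    and X: "finite X" "\<And>x. x \<in> X \<Longrightarrow> 0 \<le> \<mu> x" "(\<Sum>x\<in>X. \<mu> x) = 1"
  shows "\<exists>P. (\<Sum>x\<in>{x \<in> X. \<not> good p n r \<kappa> P (v x)}. \<mu> x) \<le> 1 / (99 * real d)"
proof -
  interpret prob_space D using ose by (simp add: lp_OSE_def)
  have \<kappa>: "\<kappa> \<ge> 1" using ose by (simp add: lp_OSE_def)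
  define G where "G = PiE {..<d} (\<lambda>_. X)"
  have finG: "finite G" using X by (auto simp: G_def intro: finite_PiE)
  define A where "A = (\<lambda>(g :: nat \<Rightarrow> 'x) (i, j). v (g j) i)"
  define E where "E g = {P \<in> space D. \<forall>x. lp_norm p n (mat_vec d (A g) x) \<le> lp_norm p r (mat_vec n P (mat_vec d (A g) x)) \<and>
        lp_norm p r (mat_vec n P (mat_vec d (A g) x)) \<le> \<kappa> * lp_norm p n (mat_vec d (A g) x)}" for g
  define w where "w g = (\<Prod>j<d. \<mu> (g j))" for g
  have E_prob: "prob (E g) \<ge> 0.99" for g
    using ose unfolding lp_OSE_def E_def by blast
  \<comment> \<open>A non-measurable set has measure \<open>0\<close>, so the probability bound carries measurability.\<close>
  have E_sets [measurable]: "E g \<in> sets D" for g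
  proof (rule ccontr)
    assume "E g \<notin> sets D"
    then have "prob (E g) = 0" by (rule measure_notin_sets)
    with E_prob[of g] show False by simp
  qed
  have w_nonneg: "0 \<le> w g" if "g \<in> G" for g
    using that X by (auto simp: w_def G_def intro!: prod_nonneg)
  have "(\<Sum>g\<in>G. w g) = (\<Prod>j<d. \<Sum>x\<in>X. \<mu> x)"
    unfolding G_def w_def using X by (intro prod_sum_PiE[symmetric]) auto
  then have w_sum: "(\<Sum>g\<in>G. w g) = 1" by (simp add: X)
  define f where "f P = (\<Sum>g\<in>G. w g * indicator (E g) P)" for P
  have f_int: "integrable D f"
    unfolding f_def by (intro Bochner_Integration.integrable_sum integrable_mult_right)
      (auto simp: integrable_indicator_iff emeasure_eq_measure)
  have "0.99 = (\<Sum>g\<in>G. w g * 0.99)"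
    by (simp only: sum_distrib_right[symmetric] w_sum)
  also have "\<dots> \<le> (\<Sum>g\<in>G. w g * prob (E g))"
    by (intro sum_mono mult_left_mono w_nonneg E_prob)
  also have "\<dots> = expectation f"
    unfolding f_def
    by (subst Bochner_Integration.integral_sum)
      (auto simp: emeasure_eq_measure intro!: integrable_mult_right integrable_real_indicator)
  \<comment> \<open>A function of mean at least 0.99 cannot be smaller than 0.99 almost
    everywhere.\<close>
  finally have "\<not> (AE P in D. f P < 0.99)"
    using expectation_less[OF f_int] by fastforce
  then obtain P where P: "P \<in> space D" "f P \<ge> 0.99"
    by (metis AE_I2 not_le)
  \<comment> \<open>Testing the embedding at the \<open>j\<close>-th unit vector isolates the
    \<open>j\<close>-th column of \<open>A g\<close>.\<close>
  have good_of_E: "good p n r \<kappa> P (v (g j))" if "P \<in> E g" "j < d" for g j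
  proof -
    have "mat_vec d (A g) (\<lambda>k. if k = j then 1 else 0) = v (g j)"
      using that(2) by (auto simp: mat_vec_def A_def if_distrib cong: if_cong)
    then show ?thesis
      using that(1) good_iff_lp_norm[OF p, of \<kappa>] \<kappa> unfolding E_def mem_Collect_eq
      by (metis less_le_trans zero_less_one)
  qed
  define b where "b = (\<Sum>x\<in>{x \<in> X. \<not> good p n r \<kappa> P (v x)}. \<mu> x)"
  have "(\<Sum>x\<in>X. \<mu> x) = (\<Sum>x\<in>{x \<in> X. good p n r \<kappa> P (v x)}. \<mu> x) + b"
    unfolding b_def using X(1) by (subst sum.union_disjoint[symmetric]) (auto intro: sum.cong)
  then have good_sum: "(\<Sum>x\<in>X. \<mu> x * of_bool (good p n r \<kappa> P (v x))) = 1 - b"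
    using X(1,3) by (simp add: sum.If_cases of_bool_def if_distrib cong: if_cong)
      (simp add: sum.inter_filter[symmetric] Int_def)
  have "f P \<le> (\<Sum>g\<in>G. \<Prod>j<d. \<mu> (g j) * of_bool (good p n r \<kappa> P (v (g j))))"
    unfolding f_def
  proof (intro sum_mono)
    fix g assume g: "g \<in> G"
    have "indicator (E g) P \<le> (\<Prod>j<d. of_bool (good p n r \<kappa> P (v (g j))) :: real)"
      using good_of_E by (auto simp: indicator_def prod_nonneg)
    then show "w g * indicator (E g) P \<le> (\<Prod>j<d. \<mu> (g j) * of_bool (good p n r \<kappa> P (v (g j))))"
      using w_nonneg[OF g] unfolding prod.distrib w_def by (intro mult_left_mono)
  qed
  \<comment> \<open>Independence of the columns: the sum over \<open>G\<close> factors into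
    \<open>d\<close> equal sums.\<close>
  also have "\<dots> = (1 - b) ^ d"
    unfolding G_def using X(1) by (subst prod_sum_PiE[symmetric]) (auto simp: good_sum)
  finally have low: "0.99 \<le> (1 - b) ^ d" using P(2) by simp
  have b: "0 \<le> b" "b \<le> 1"
  proof -
    show "0 \<le> b" unfolding b_def using X(2) by (intro sum_nonneg) auto
    have "0 \<le> (\<Sum>x\<in>X. \<mu> x * of_bool (good p n r \<kappa> P (v x)))"
      using X(2) by (intro sum_nonneg) auto
    then show "b \<le> 1" unfolding good_sum by simp
  qed
  \<comment> \<open>Multiplying by \<open>(1 + b) ^ d\<close> makes the condition linear in
    \<open>b\<close>: Bernoulli bounds this factor below, and \<open>(1 - b\<^sup>2) ^ d\<close> is
    at most 1.\<close>
  have "(1 + real d * b) * 0.99 \<le> (1 + b) ^ d * (1 - b) ^ d"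
    using b low by (intro mult_mono Bernoulli_inequality) auto
  also have "\<dots> = (1 - b\<^sup>2) ^ d"
    by (simp add: power_mult_distrib[symmetric] power2_eq_square algebra_simps)
  also have "\<dots> \<le> 1"
    using b by (intro power_le_one) (auto simp: power_le_one)
  finally have "real d * b * 99 \<le> 1" by simp
  then have "b \<le> 1 / (99 * real d)"
    using d by (simp add: field_simps)
  then show ?thesis unfolding b_def by blast
qed

text \<open>Draw \<open>s\<close> uniformly from \<open>I\<close>, then \<open>\<omega>\<close>
  uniformly from \<open>\<Omega> s\<close>. Each family has weight \<open>1 / card I\<close> in this
  mixture, so failing on one family is at most \<open>card I\<close> times as likely as failing on
  the mixture.\<close>

lemma lp_OSE_random_families:
  fixes v :: "'s \<Rightarrow> 'x \<Rightarrow> nat \<Rightarrow> real"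
  assumes ose: "lp_OSE p n d r \<kappa> D" and p: "1 \<le> p" and d: "1 \<le> d"
    and I: "finite I" "\<And>s. s \<in> I \<Longrightarrow> finite (\<Omega> s)" "\<And>s. s \<in> I \<Longrightarrow> \<Omega> s \<noteq> {}"
  shows "\<exists>P. \<forall>s\<in>I. real (card {\<omega> \<in> \<Omega> s. \<not> good p n r \<kappa> P (v s \<omega>)})
           \<le> real (card I) / (99 * real d) * real (card (\<Omega> s))"
proof (cases "I = {}")
  case False
  define \<mu> where "\<mu> = (\<lambda>(s, \<omega> :: 'x). 1 / (real (card I) * real (card (\<Omega> s))))"
  have cI: "card I > 0" using False I by (simp add: card_gt_0_iff)
  have c\<Omega>: "card (\<Omega> s) > 0" if "s \<in> I" for s using that I by (simp add: card_gt_0_iff)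
  have "(\<Sum>x\<in>Sigma I \<Omega>. \<mu> x) = (\<Sum>s\<in>I. \<Sum>\<omega>\<in>\<Omega> s. \<mu> (s, \<omega>))"
    using I by (subst sum.Sigma) auto
  also have "\<dots> = (\<Sum>s\<in>I. 1 / real (card I))"
    using c\<Omega> by (intro sum.cong) (auto simp: \<mu>_def dest: less_imp_neq)
  also have "\<dots> = 1" using cI by simp
  finally have \<mu>_sum: "(\<Sum>x\<in>Sigma I \<Omega>. \<mu> x) = 1" .
  obtain P where P: "(\<Sum>x\<in>{x \<in> Sigma I \<Omega>. \<not> good p n r \<kappa> P (case_prod v x)}. \<mu> x) \<le> 1 / (99 * real d)"
    using lp_OSE_random_vector[OF ose p d, of "Sigma I \<Omega>" \<mu> "case_prod v"] I \<mu>_sum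
    by (force simp: \<mu>_def finite_SigmaI)
  have "real (card {\<omega> \<in> \<Omega> s. \<not> good p n r \<kappa> P (v s \<omega>)})
       \<le> real (card I) / (99 * real d) * real (card (\<Omega> s))" if s: "s \<in> I" for s
  proof -
    let ?B = "{\<omega> \<in> \<Omega> s. \<not> good p n r \<kappa> P (v s \<omega>)}"
    have "card ?B / (real (card I) * real (card (\<Omega> s))) = (\<Sum>x\<in>Pair s ` ?B. \<mu> x)"
      by (subst sum.reindex) (auto simp: inj_on_def \<mu>_def)
    also have "\<dots> \<le> (\<Sum>x\<in>{x \<in> Sigma I \<Omega>. \<not> good p n r \<kappa> P (case_prod v x)}. \<mu> x)"
      using I s by (intro sum_mono2) (auto simp: \<mu>_def)
    also note P
    finally have "card ?B / (real (card I) * real (card (\<Omega> s))) \<le> 1 / (99 * real d)" .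
    then have "card ?B \<le> 1 / (99 * real d) * (real (card I) * real (card (\<Omega> s)))"
      using cI c\<Omega>[OF s] by (subst (asm) pos_divide_le_eq) auto
    then show ?thesis by simp
  qed
  then show ?thesis by blast
qed simp

section \<open>Random signs\<close>

text \<open>A sign pattern is stored as the set of its positive positions, so that uniform signs on
  \<open>A\<close> become uniform subsets in \<open>Pow A\<close>.\<close>

definition sgns :: "nat set \<Rightarrow> nat \<Rightarrow> real" where
  "sgns S g = (if g \<in> S then 1 else - 1)"

text \<open>Orthogonality of independent signs: the two signs of a newly added index give
  \<open>(y - c)\<^sup>2 + (y + c)\<^sup>2\<close>, where the cross terms cancel.\<close>

lemma sum_sgns_square:
  fixes c :: "nat \<Rightarrow> real"
  assumes "finite A"
  shows "(\<Sum>S\<in>Pow A. (\<Sum>g\<in>A. sgns S g * c g)\<^sup>2) = 2 ^ card A * (\<Sum>g\<in>A. (c g)\<^sup>2)"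
  using assms
proof (induction A rule: finite_induct)
  case (insert a A)
  let ?y = "\<lambda>S. \<Sum>g\<in>A. sgns S g * c g"
  have inj: "inj_on (insert a) (Pow A)"
    using insert by (auto simp: inj_on_def)
  have eq: "(\<Sum>g\<in>A. sgns (insert a S) g * c g) = ?y S" for S
    using insert by (intro sum.cong) (auto simp: sgns_def)
  have "(\<Sum>S\<in>Pow (insert a A). (\<Sum>g\<in>insert a A. sgns S g * c g)\<^sup>2)
      = (\<Sum>S\<in>Pow A. (sgns S a * c a + ?y S)\<^sup>2) + (\<Sum>S\<in>Pow A. (sgns (insert a S) a * c a + ?y S)\<^sup>2)"
    using insert unfolding Pow_insert
    by (subst sum.union_disjoint) (auto simp: sum.reindex[OF inj] eq)
  also have "(\<Sum>S\<in>Pow A. (sgns S a * c a + ?y S)\<^sup>2) = (\<Sum>S\<in>Pow A. (?y S - c a)\<^sup>2)"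
    using insert by (intro sum.cong) (auto simp: sgns_def)
  also have "(\<Sum>S\<in>Pow A. (sgns (insert a S) a * c a + ?y S)\<^sup>2) = (\<Sum>S\<in>Pow A. (?y S + c a)\<^sup>2)"
    by (intro sum.cong) (auto simp: sgns_def add.commute)
  also have "(\<Sum>S\<in>Pow A. (?y S - c a)\<^sup>2) + (\<Sum>S\<in>Pow A. (?y S + c a)\<^sup>2)
      = (\<Sum>S\<in>Pow A. 2 * (?y S)\<^sup>2 + 2 * (c a)\<^sup>2)"
    unfolding sum.distrib[symmetric] by (intro sum.cong) (auto simp: power2_sum power2_diff)
  also have "\<dots> = 2 * (\<Sum>S\<in>Pow A. (?y S)\<^sup>2) + 2 ^ card A * (2 * (c a)\<^sup>2)"
    using insert by (simp add: sum.distrib sum_distrib_left[symmetric] card_Pow)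
  also have "\<dots> = 2 * (2 ^ card A * (\<Sum>g\<in>A. (c g)\<^sup>2)) + 2 ^ card A * (2 * (c a)\<^sup>2)"
    by (simp only: insert.IH)
  finally show ?case using insert.hyps by (simp add: distrib_left)
qed simp

text \<open>Flipping the sign of one summand pairs off the sign patterns, and by convexity one member of
  each pair is at least as long as that summand.\<close>

lemma half_sgns_large:
  fixes c :: "nat \<Rightarrow> nat \<Rightarrow> real"
  assumes "finite A" "h \<in> A" "1 \<le> p"
  shows "2 ^ card A \<le> 2 * card {S \<in> Pow A. npow p r (c h) \<le> npow p r (\<lambda>i. \<Sum>g\<in>A. sgns S g * c g i)}"
proof -
  let ?y = "\<lambda>S i. \<Sum>g\<in>A. sgns S g * c g i"
  let ?B = "{S \<in> Pow A. npow p r (c h) \<le> npow p r (?y S)}"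
  define flip where "flip S = (if h \<in> S then S - {h} else insert h S)" for S
  have mid: "a \<le> b \<or> a \<le> c" if "a \<le> (b + c) / 2" for a b c :: real
    using that by auto
  have flip_inv: "flip (flip S) = S" for S by (auto simp: flip_def)
  have "S \<in> ?B \<union> flip ` ?B" if S: "S \<in> Pow A" for S
  proof -
    have fS: "flip S \<in> Pow A" using S assms by (auto simp: flip_def)
    have y: "?y S i = sgns S h * c h i + (\<Sum>g\<in>A - {h}. sgns S g * c g i)" for S i
      using assms by (simp add: sum.remove)
    have "(\<Sum>g\<in>A - {h}. sgns (flip S) g * c g i) = (\<Sum>g\<in>A - {h}. sgns S g * c g i)" for i
      by (intro sum.cong) (auto simp: sgns_def flip_def)
    moreover have "sgns (flip S) h = - sgns S h" by (auto simp: sgns_def flip_def)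
    ultimately have diff: "sgns S h * c h i = (?y S i + - ?y (flip S) i) / 2" for i
      unfolding y[of S] y[of "flip S"] by simp
    have "\<bar>c h i\<bar> powr p \<le> (\<bar>?y S i\<bar> powr p + \<bar>?y (flip S) i\<bar> powr p) / 2" for i
    proof -
      have "\<bar>c h i\<bar> = \<bar>(?y S i + - ?y (flip S) i) / 2\<bar>"
        unfolding diff[symmetric] by (simp add: sgns_def)
      with powr_midpoint[OF assms(3), of "?y S i" "- ?y (flip S) i"] show ?thesis
        by (simp only: abs_minus_cancel)
    qed
    then have "npow p r (c h) \<le> (\<Sum>i<r. (\<bar>?y S i\<bar> powr p + \<bar>?y (flip S) i\<bar> powr p) / 2)"
      unfolding npow_def by (rule sum_mono)
    also have "\<dots> = (npow p r (?y S) + npow p r (?y (flip S))) / 2"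
      by (simp add: npow_def sum.distrib sum_divide_distrib add_divide_distrib)
    finally have "npow p r (c h) \<le> npow p r (?y S) \<or> npow p r (c h) \<le> npow p r (?y (flip S))"
      by (rule mid)
    then show ?thesis
    proof
      assume "npow p r (c h) \<le> npow p r (?y S)"
      then show ?thesis using S by blast
    next
      assume "npow p r (c h) \<le> npow p r (?y (flip S))"
      then have "flip (flip S) \<in> flip ` ?B" using fS by blast
      then show ?thesis unfolding flip_inv by (rule UnI2)
    qed
  qed
  then have "card (Pow A) \<le> card (?B \<union> flip ` ?B)"
    using assms by (intro card_mono) auto
  also have "\<dots> \<le> card ?B + card (flip ` ?B)" by (rule card_Un_le)
  also have "\<dots> \<le> card ?B + card ?B"
    using assms by (intro add_left_mono card_image_le) auto
  finally show ?thesis using assms by (simp add: card_Pow)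
qed

section \<open>Random block vectors and the number of heavy columns\<close>

text \<open>Of \<open>m\<close> consecutive blocks of length \<open>q\<close>, block \<open>g\<close> carries one entry, at offset \<open>u g\<close>, of sign
  \<open>sgns S g\<close>.\<close>

definition pick :: "nat \<Rightarrow> nat \<Rightarrow> (nat \<Rightarrow> nat) \<Rightarrow> nat set \<Rightarrow> nat \<Rightarrow> real" where
  "pick m q u S j = (if j < m * q \<and> u (j div q) = j mod q then sgns S (j div q) else 0)"

text \<open>Position \<open>j\<close> lies in block \<open>j div q\<close> at offset
  \<open>j mod q\<close>, so exactly one position per block survives. Both the norm and the image of
  \<open>pick\<close> reduce to this.\<close>

lemma sum_pick:
  fixes F :: "nat \<Rightarrow> real"
  assumes "m * q \<le> n" "u \<in> {..<m} \<rightarrow>\<^sub>E {..<q}"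
  shows "(\<Sum>j<n. if j < m * q \<and> u (j div q) = j mod q then F j else 0) = (\<Sum>g<m. F (g * q + u g))"
proof -
  let ?f = "\<lambda>j. if u (j div q) = j mod q then F j else 0"
  have "(\<Sum>j<n. if j < m * q \<and> u (j div q) = j mod q then F j else 0) = (\<Sum>j<m * q. ?f j)"
    using assms(1) by (intro sum.mono_neutral_cong_right) auto
  also have "\<dots> = (\<Sum>g<m. \<Sum>j=g * q..<g * q + q. ?f j)"
    by (rule sum.nat_group[symmetric])
  also have "\<dots> = (\<Sum>g<m. F (g * q + u g))"
  proof (intro sum.cong refl)
    fix g assume "g \<in> {..<m}"
    then have u: "u g < q" using assms(2) by auto
    have "(\<Sum>j=g * q..<g * q + q. ?f j) = (\<Sum>a=0..<q. ?f (a + g * q))"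
      using sum.shift_bounds_nat_ivl[of ?f 0 "g * q" q] by (simp add: add.commute)
    also have "\<dots> = (\<Sum>a=0..<q. if a = u g then F (a + g * q) else 0)"
      by (intro sum.cong) (auto simp: div_add1_eq)
    also have "\<dots> = F (g * q + u g)" using u by (simp add: add.commute)
    finally show "(\<Sum>j=g * q..<g * q + q. ?f j) = F (g * q + u g)" .
  qed
  finally show ?thesis .
qed

lemma npow_pick:
  assumes "m * q \<le> n" "u \<in> {..<m} \<rightarrow>\<^sub>E {..<q}"
  shows "npow p n (pick m q u S) = real m"
proof -
  have "npow p n (pick m q u S) = (\<Sum>j<n. if j < m * q \<and> u (j div q) = j mod q then 1 else 0)"
    unfolding npow_def by (intro sum.cong) (auto simp: pick_def sgns_def)
  then show ?thesis using sum_pick[OF assms, of "\<lambda>_. 1"] by simp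
qed

lemma mat_vec_pick:
  assumes "m * q \<le> n" "u \<in> {..<m} \<rightarrow>\<^sub>E {..<q}"
  shows "mat_vec n P (pick m q u S) i = (\<Sum>g<m. sgns S g * P (i, g * q + u g))"
proof -
  have "mat_vec n P (pick m q u S) i
      = (\<Sum>j<n. if j < m * q \<and> u (j div q) = j mod q then sgns S (j div q) * P (i, j) else 0)"
    unfolding mat_vec_def by (intro sum.cong) (auto simp: pick_def)
  also have "\<dots> = (\<Sum>g<m. sgns S ((g * q + u g) div q) * P (i, g * q + u g))"
    by (rule sum_pick[OF assms])
  also have "\<dots> = (\<Sum>g<m. sgns S g * P (i, g * q + u g))"
  proof (intro sum.cong refl)
    fix g assume "g \<in> {..<m}"
    then have "u g < q" using assms(2) by auto
    then have "(g * q + u g) div q = g" by simp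
    then show "sgns S ((g * q + u g) div q) * P (i, g * q + u g) = sgns S g * P (i, g * q + u g)"
      by simp
  qed
  finally show ?thesis .
qed

text \<open>A uniform offset avoids \<open>H\<close> in a block containing \<open>h\<close> of its
  elements with probability \<open>1 - h / q\<close>. The product over blocks is at most
  \<open>exp (- (card H / q))\<close>, and \<open>1 + card H / q\<close> is at most the inverse of
  this.\<close>

lemma card_avoiding_blocks:
  assumes q: "0 < q" and H: "H \<subseteq> {..<m * q}"
  shows "real (card {u \<in> {..<m} \<rightarrow>\<^sub>E {..<q}. \<forall>g<m. g * q + u g \<notin> H}) * (1 + card H / q) \<le> real (q ^ m)"
proof -
  let ?h = "\<lambda>g. card {a \<in> {..<q}. g * q + a \<in> H}"
  have h_le: "?h g \<le> q" for g
    using card_mono[of "{..<q}" "{a \<in> {..<q}. g * q + a \<in> H}"] by (auto simp del: mem_Collect_eq)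
  have "real (card H) = (\<Sum>j<m * q. if j \<in> H then 1 else 0)"
    using H by (simp add: sum.If_cases Int_absorb1)
  also have "\<dots> = (\<Sum>g<m. \<Sum>j=g * q..<g * q + q. if j \<in> H then 1 else 0)"
    by (rule sum.nat_group[symmetric])
  also have "\<dots> = (\<Sum>g<m. real (?h g))"
  proof (intro sum.cong refl)
    fix g
    have "(\<Sum>j=g * q..<g * q + q. if j \<in> H then 1 else 0) = (\<Sum>a=0..<q. if a + g * q \<in> H then 1 else (0::real))"
      using sum.shift_bounds_nat_ivl[of "\<lambda>j. if j \<in> H then 1 else 0" 0 "g * q" q] by (simp add: add.commute)
    then show "(\<Sum>j=g * q..<g * q + q. if j \<in> H then 1 else 0) = real (?h g)"
      by (simp add: sum.If_cases Int_def add.commute atLeast0LessThan)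
  qed
  finally have H_sum: "real (card H) = (\<Sum>g<m. real (?h g))" .
  have "{u \<in> {..<m} \<rightarrow>\<^sub>E {..<q}. \<forall>g<m. g * q + u g \<notin> H} = (\<Pi>\<^sub>E g\<in>{..<m}. {a \<in> {..<q}. g * q + a \<notin> H})"
    unfolding set_eq_iff PiE_iff mem_Collect_eq lessThan_iff Ball_def by blast
  then have "real (card {u \<in> {..<m} \<rightarrow>\<^sub>E {..<q}. \<forall>g<m. g * q + u g \<notin> H})
      = (\<Prod>g<m. real (card {a \<in> {..<q}. g * q + a \<notin> H}))"
    by (simp only: card_PiE finite_lessThan of_nat_prod)
  also have "\<dots> = (\<Prod>g<m. q * (1 - ?h g / q))"
  proof (intro prod.cong refl)
    fix g
    have "card ({..<q} - {a \<in> {..<q}. g * q + a \<in> H}) = card {..<q} - ?h g"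
      by (intro card_Diff_subset) auto
    moreover have "{a \<in> {..<q}. g * q + a \<notin> H} = {..<q} - {a \<in> {..<q}. g * q + a \<in> H}" by auto
    ultimately have "card {a \<in> {..<q}. g * q + a \<notin> H} = q - ?h g"
      by (simp only: card_lessThan)
    then have "real (card {a \<in> {..<q}. g * q + a \<notin> H}) = real q - real (?h g)"
      using h_le[of g] by (simp only: of_nat_diff)
    then show "real (card {a \<in> {..<q}. g * q + a \<notin> H}) = q * (1 - ?h g / q)"
      using q by (simp add: right_diff_distrib)
  qed
  also have "\<dots> \<le> (\<Prod>g<m. q * exp (- (?h g / q)))"
  proof (intro prod_mono conjI)
    fix g
    have "real (?h g) / real q \<le> 1"
      using h_le[of g] q by (subst pos_divide_le_eq) auto
    then show "0 \<le> q * (1 - ?h g / q)" by simp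
    show "q * (1 - ?h g / q) \<le> q * exp (- (?h g / q))"
      using exp_ge_add_one_self[of "- (?h g / q)"] by (intro mult_left_mono) auto
  qed
  also have "\<dots> = real q ^ m * exp (- (card H / q))"
    by (simp add: prod.distrib exp_sum[symmetric] H_sum sum_negf sum_divide_distrib)
  finally have "real (card {u \<in> {..<m} \<rightarrow>\<^sub>E {..<q}. \<forall>g<m. g * q + u g \<notin> H}) * (1 + card H / q)
      \<le> real q ^ m * exp (- (card H / q)) * exp (card H / q)"
    by (intro mult_mono exp_ge_add_one_self) auto
  also have "\<dots> = real (q ^ m)" by (simp add: mult.assoc exp_minus_inverse mult.commute[of "exp (- _)"])
  finally show ?thesis .
qed

text \<open>Offsets that meet a heavy column fail for at least half of the signs, so they form at
  most a fraction \<open>2 * \<delta>\<close> of all offsets. Many heavy columns would make avoiding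
  them too rare for that, by \<open>card_avoiding_blocks\<close>.\<close>

lemma card_heavy_le:
  assumes q: "0 < q" and n: "m * q \<le> n" and p: "1 \<le> p"
    and \<delta>: "\<delta> \<le> 1 / 8"
    and bad: "real (card {(u, S) \<in> ({..<m} \<rightarrow>\<^sub>E {..<q}) \<times> Pow {..<m}. \<not> good p n r \<kappa> P (pick m q u S)})
        \<le> \<delta> * real (card (({..<m} \<rightarrow>\<^sub>E {..<q}) \<times> Pow {..<m}))"
  shows "real (card {j. j < m * q \<and> \<kappa> powr p * real m < npow p r (\<lambda>i. P (i, j))}) \<le> 4 * \<delta> * real q"
proof -
  define H where "H = {j. j < m * q \<and> \<kappa> powr p * real m < npow p r (\<lambda>i. P (i, j))}"
  define U where "U = {..<m} \<rightarrow>\<^sub>E {..<q}"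
  define V where "V = {u \<in> U. \<forall>g<m. g * q + u g \<notin> H}"
  let ?B = "\<lambda>u. {S \<in> Pow {..<m}. \<not> good p n r \<kappa> P (pick m q u S)}"
  have finU: "finite U" unfolding U_def by (intro finite_PiE) auto
  have cU: "card U = q ^ m" by (simp add: U_def card_PiE)
  have VU: "V \<subseteq> U" by (auto simp: V_def)
  have hit: "2 ^ m \<le> 2 * card (?B u)" if u: "u \<in> U - V" for u
  proof -
    from u obtain g where g: "g < m" "g * q + u g \<in> H" and uU: "u \<in> U" by (auto simp: V_def)
    have "2 ^ m \<le> 2 * card {S \<in> Pow {..<m}. npow p r (\<lambda>i. P (i, g * q + u g))
        \<le> npow p r (\<lambda>i. \<Sum>g<m. sgns S g * P (i, g * q + u g))}"
      using half_sgns_large[of "{..<m}" g p r "\<lambda>g i. P (i, g * q + u g)"] g p by simp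
    also have "\<dots> \<le> 2 * card (?B u)"
    proof (intro mult_left_mono card_mono subsetI)
      fix S assume S: "S \<in> {S \<in> Pow {..<m}. npow p r (\<lambda>i. P (i, g * q + u g))
        \<le> npow p r (\<lambda>i. \<Sum>g<m. sgns S g * P (i, g * q + u g))}"
      have "mat_vec n P (pick m q u S) = (\<lambda>i. \<Sum>g<m. sgns S g * P (i, g * q + u g))"
        using mat_vec_pick[OF n] uU by (auto simp: U_def)
      moreover have "npow p n (pick m q u S) = real m"
        using npow_pick[OF n] uU by (auto simp: U_def)
      \<comment> \<open>The vector has \<open>npow\<close> equal to \<open>m\<close>, so an image at
        least as long as a heavy column breaks the upper bound.\<close>
      ultimately show "S \<in> ?B u"
        using S g(2) by (auto simp: good_def H_def)
    qed auto
    finally show ?thesis .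
  qed
  have "real (card (U - V)) * 2 ^ m = (\<Sum>u\<in>U - V. 2 ^ m)" by simp
  also have "\<dots> \<le> (\<Sum>u\<in>U - V. 2 * real (card (?B u)))"
  proof (rule sum_mono)
    fix u assume "u \<in> U - V"
    then have "real (2 ^ m) \<le> real (2 * card (?B u))" using hit by (intro of_nat_mono)
    then show "2 ^ m \<le> 2 * real (card (?B u))" by simp
  qed
  also have "\<dots> \<le> (\<Sum>u\<in>U. 2 * real (card (?B u)))"
    using finU by (intro sum_mono2) auto
  also have "\<dots> = 2 * real (card (Sigma U ?B))"
    using finU by (simp add: card_SigmaI sum_distrib_left)
  also have "Sigma U ?B = {(u, S) \<in> U \<times> Pow {..<m}. \<not> good p n r \<kappa> P (pick m q u S)}"
    by auto
  also have "2 * real (card \<dots>) \<le> 2 * (\<delta> * (real (q ^ m) * 2 ^ m))"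
    using bad by (simp add: U_def[symmetric] card_cartesian_product cU card_Pow)
  finally have "(real (card (U - V))) * 2 ^ m \<le> (2 * \<delta> * real (q ^ m)) * 2 ^ m"
    by (simp add: mult_ac)
  then have "real (card (U - V)) \<le> 2 * \<delta> * real (q ^ m)"
    by (rule mult_right_le_imp_le) simp
  moreover have "real (card (U - V)) = real (q ^ m) - real (card V)"
    using card_mono[OF finU VU] by (simp add: card_Diff_subset[OF finite_subset[OF VU finU] VU] cU of_nat_diff)
  ultimately have "(1 - 2 * \<delta>) * real (q ^ m) \<le> real (card V)"
    by (simp add: algebra_simps)
  then have "(1 - 2 * \<delta>) * real (q ^ m) * (1 + card H / q) \<le> real (card V) * (1 + card H / q)"
    by (intro mult_right_mono) auto
  also have "\<dots> \<le> real (q ^ m)"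
    unfolding V_def U_def using card_avoiding_blocks[OF q, of H m] by (auto simp: H_def)
  finally have "((1 - 2 * \<delta>) * (1 + card H / q)) * real (q ^ m) \<le> 1 * real (q ^ m)"
    by (simp add: mult_ac)
  then have "(1 - 2 * \<delta>) * (1 + card H / q) \<le> 1"
    by (rule mult_right_le_imp_le) (use q in simp)
  \<comment> \<open>With \<open>h = card H / q\<close> the inequality above reads
    \<open>h \<le> 2 * \<delta> + 2 * \<delta> * h\<close>, and half of \<open>h\<close> absorbs the
    last product.\<close>
  moreover have "2 * \<delta> * (card H / q) \<le> 1 / 2 * (card H / q)"
    using \<delta> by (intro mult_right_mono) auto
  ultimately have "card H / q \<le> 4 * \<delta>"
    by (simp add: algebra_simps)
  then show ?thesis using q by (simp add: H_def field_simps)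
qed

section \<open>Average length of the image of a sign vector\<close>

text \<open>In each row, concavity over the sign patterns reduces to the exact second moment.
  Subadditivity at exponent \<open>p / 2\<close> then splits off the heavy columns in
  \<open>H\<close>; for the light ones concavity over the rows gives the factor in
  \<open>r\<close>.\<close>

lemma sum_sgns_npow_le:
  fixes P :: "nat \<times> nat \<Rightarrow> real"
  assumes A: "finite A" "H \<subseteq> A" and p: "1 \<le> p" "p < 2" and K: "0 \<le> K"
    and light: "\<And>j. j \<in> A - H \<Longrightarrow> npow p r (\<lambda>i. P (i, j)) \<le> K"
  shows "(\<Sum>S\<in>Pow A. npow p r (\<lambda>i. \<Sum>g\<in>A. sgns S g * P (i, g)))
    \<le> 2 ^ card A * ((\<Sum>j\<in>H. npow p r (\<lambda>i. P (i, j)))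
        + real r powr (1 - p / 2) * real (card A) powr (p / 2) * K)"
proof -
  define \<theta> where "\<theta> = p / 2"
  have \<theta>: "0 < \<theta>" "\<theta> \<le> 1" using p by (auto simp: \<theta>_def)
  have abs_powr: "\<bar>x\<bar> powr p = (x\<^sup>2) powr \<theta>" for x :: real
    unfolding \<theta>_def by (rule abs_powr_eq_square_powr)
  define L where "L i = (\<Sum>j\<in>A - H. (P (i, j))\<^sup>2)" for i
  have finH: "finite H" using A finite_subset by blast
  have row: "(\<Sum>S\<in>Pow A. \<bar>\<Sum>g\<in>A. sgns S g * P (i, g)\<bar> powr p)
      \<le> 2 ^ card A * ((\<Sum>j\<in>H. \<bar>P (i, j)\<bar> powr p) + L i powr \<theta>)" for i
  proof -
    have "(\<Sum>S\<in>Pow A. \<bar>\<Sum>g\<in>A. sgns S g * P (i, g)\<bar> powr p)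
        \<le> real (card (Pow A)) powr (1 - \<theta>) * (\<Sum>S\<in>Pow A. (\<Sum>g\<in>A. sgns S g * P (i, g))\<^sup>2) powr \<theta>"
      unfolding abs_powr using A \<theta> by (intro sum_powr_le_card) auto
    also have "\<dots> = (2 ^ card A) powr (1 - \<theta>) * (2 ^ card A) powr \<theta> * (\<Sum>g\<in>A. (P (i, g))\<^sup>2) powr \<theta>"
      by (simp only: sum_sgns_square[OF A(1)] card_Pow[OF A(1)] powr_mult mult.assoc of_nat_power of_nat_numeral)
    also have "(2 ^ card A) powr (1 - \<theta>) * (2 ^ card A) powr \<theta> = (2 ^ card A :: real)"
      by (simp add: powr_add[symmetric])
    also have "(\<Sum>g\<in>A. (P (i, g))\<^sup>2) = (\<Sum>j\<in>H. (P (i, j))\<^sup>2) + L i"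
      unfolding L_def using A by (simp add: sum.subset_diff add.commute)
    also have "(\<dots>) powr \<theta> \<le> (\<Sum>j\<in>H. (P (i, j))\<^sup>2) powr \<theta> + L i powr \<theta>"
      unfolding L_def using \<theta> by (intro powr_add_subadditive sum_nonneg) auto
    also have "(\<Sum>j\<in>H. (P (i, j))\<^sup>2) powr \<theta> \<le> (\<Sum>j\<in>H. \<bar>P (i, j)\<bar> powr p)"
      unfolding abs_powr using \<theta> finH by (intro sum_powr_subadditive) auto
    finally show ?thesis by simp
  qed
  \<comment> \<open>The Euclidean norm of a column is at most its \<open>p\<close>-norm, because
    \<open>p < 2\<close>.\<close>
  have col: "(\<Sum>i<r. (P (i, j))\<^sup>2) \<le> K powr (1 / \<theta>)" if "j \<in> A - H" for j
  proof -
    have "(\<Sum>i<r. (P (i, j))\<^sup>2) powr \<theta> \<le> (\<Sum>i<r. (P (i, j))\<^sup>2 powr \<theta>)"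
      using \<theta> by (intro sum_powr_subadditive) auto
    also have "\<dots> \<le> K" using light[OF that] by (simp only: npow_def abs_powr)
    finally have "((\<Sum>i<r. (P (i, j))\<^sup>2) powr \<theta>) powr (1 / \<theta>) \<le> K powr (1 / \<theta>)"
      using \<theta> by (intro powr_mono2) auto
    then show ?thesis using \<theta> by (simp add: powr_powr sum_nonneg)
  qed
  have L_nonneg: "0 \<le> L i" for i by (simp add: L_def sum_nonneg)
  have "(\<Sum>i<r. L i) = (\<Sum>j\<in>A - H. \<Sum>i<r. (P (i, j))\<^sup>2)"
    unfolding L_def by (rule sum.swap)
  also have "\<dots> \<le> real (card (A - H)) * K powr (1 / \<theta>)"
    using sum_bounded_above[OF col] .
  also have "\<dots> \<le> real (card A) * K powr (1 / \<theta>)"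
    using A by (intro mult_right_mono) (auto intro: card_mono)
  finally have L_total: "(\<Sum>i<r. L i) \<le> real (card A) * K powr (1 / \<theta>)" .
  have "(\<Sum>i<r. L i powr \<theta>) \<le> real (card {..<r}) powr (1 - \<theta>) * (\<Sum>i<r. L i) powr \<theta>"
    using \<theta> by (intro sum_powr_le_card) (auto simp: L_nonneg)
  also have "\<dots> \<le> real r powr (1 - \<theta>) * (real (card A) * K powr (1 / \<theta>)) powr \<theta>"
    unfolding card_lessThan using \<theta> L_total
    by (intro mult_left_mono powr_mono2) (auto simp: L_nonneg intro: sum_nonneg)
  also have "(real (card A) * K powr (1 / \<theta>)) powr \<theta> = real (card A) powr \<theta> * K"
    using K \<theta> by (simp add: powr_mult powr_powr)
  finally have Lsum: "(\<Sum>i<r. L i powr \<theta>) \<le> real r powr (1 - \<theta>) * real (card A) powr \<theta> * K"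
    by (simp only: mult.assoc)
  have "(\<Sum>S\<in>Pow A. npow p r (\<lambda>i. \<Sum>g\<in>A. sgns S g * P (i, g)))
      = (\<Sum>i<r. \<Sum>S\<in>Pow A. \<bar>\<Sum>g\<in>A. sgns S g * P (i, g)\<bar> powr p)"
    unfolding npow_def by (rule sum.swap)
  also have "\<dots> \<le> (\<Sum>i<r. 2 ^ card A * ((\<Sum>j\<in>H. \<bar>P (i, j)\<bar> powr p) + L i powr \<theta>))"
    by (intro sum_mono row)
  also have "\<dots> = 2 ^ card A * ((\<Sum>i<r. \<Sum>j\<in>H. \<bar>P (i, j)\<bar> powr p) + (\<Sum>i<r. L i powr \<theta>))"
    by (simp only: sum.distrib sum_distrib_left[symmetric])
  also have "(\<Sum>i<r. \<Sum>j\<in>H. \<bar>P (i, j)\<bar> powr p) = (\<Sum>j\<in>H. npow p r (\<lambda>i. P (i, j)))"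
    unfolding npow_def by (rule sum.swap)
  also have "2 ^ card A * ((\<Sum>j\<in>H. npow p r (\<lambda>i. P (i, j))) + (\<Sum>i<r. L i powr \<theta>))
      \<le> 2 ^ card A * ((\<Sum>j\<in>H. npow p r (\<lambda>i. P (i, j)))
        + real r powr (1 - \<theta>) * real (card A) powr \<theta> * K)"
    by (intro mult_left_mono add_left_mono Lsum) auto
  finally show ?thesis unfolding \<theta>_def .
qed

section \<open>The bound at a fixed dyadic size\<close>

text \<open>The square arises because \<open>t\<close> enters twice: through the mixture of
  \<open>t + 1\<close> scales and through the sum over scales.\<close>

lemma lp_OSE_dyadic_bound:
  assumes ose: "lp_OSE p n d r \<kappa> D" and p: "1 \<le> p" "p < 2" and d: "1 \<le> d" and t: "2 ^ t \<le> n"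
  shows "3 / 4 \<le> \<kappa> powr p * ((real t + 1)\<^sup>2 / real d + (real r / 2 ^ t) powr (1 - p / 2))"
proof -
  have \<kappa>: "1 \<le> \<kappa>" using ose by (simp add: lp_OSE_def)
  then have \<kappa>p: "1 \<le> \<kappa> powr p" using p by (simp add: ge_one_powr_ge_zero)
  define \<delta> where "\<delta> = (real t + 1) / (99 * real d)"
  show ?thesis
  proof (cases "\<delta> \<le> 1 / 8")
    \<comment> \<open>Here \<open>d\<close> is so small compared with \<open>t\<close> that the
      first term alone exceeds the claim.\<close>
    case False
    then have "99 / 8 * real d \<le> real t + 1"
      using d by (simp add: \<delta>_def field_simps)
    also have "\<dots> \<le> (real t + 1)\<^sup>2" by (rule self_le_power) auto
    finally have "99 / 8 \<le> (real t + 1)\<^sup>2 / real d"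
      using d by (subst pos_le_divide_eq) auto
    then have "3 / 4 \<le> (real t + 1)\<^sup>2 / real d + (real r / 2 ^ t) powr (1 - p / 2)"
      using powr_ge_zero[of "real r / 2 ^ t" "1 - p / 2"] by linarith
    also have "\<dots> \<le> \<kappa> powr p * ((real t + 1)\<^sup>2 / real d + (real r / 2 ^ t) powr (1 - p / 2))"
      using mult_right_mono[OF \<kappa>p, of "(real t + 1)\<^sup>2 / real d + (real r / 2 ^ t) powr (1 - p / 2)"]
      by simp
    finally show ?thesis .
  next
    case True
    define \<Omega> where "\<Omega> k = ({..<2 ^ k :: nat} \<rightarrow>\<^sub>E {..<2 ^ (t - k) :: nat}) \<times> Pow {..<2 ^ k :: nat}" for k
    have "finite (\<Omega> k)" "\<Omega> k \<noteq> {}" for k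
      by (auto simp: \<Omega>_def PiE_eq_empty_iff lessThan_empty_iff intro!: finite_PiE)
    then obtain P where P: "\<forall>k\<in>{..t}. real (card {\<omega> \<in> \<Omega> k. \<not> good p n r \<kappa> P
          ((\<lambda>(u, S). pick (2 ^ k) (2 ^ (t - k)) u S) \<omega>)})
        \<le> real (card {..t}) / (99 * real d) * real (card (\<Omega> k))"
      using lp_OSE_random_families[OF ose p(1) d, of "{..t}" \<Omega>
          "\<lambda>k (u, S). pick (2 ^ k) (2 ^ (t - k)) u S"] by auto
    have bad: "real (card {(u, S) \<in> \<Omega> k. \<not> good p n r \<kappa> P (pick (2 ^ k) (2 ^ (t - k)) u S)})
        \<le> \<delta> * real (card (\<Omega> k))" if "k \<le> t" for k
    proof -
      have "{\<omega> \<in> \<Omega> k. \<not> good p n r \<kappa> P ((\<lambda>(u, S). pick (2 ^ k) (2 ^ (t - k)) u S) \<omega>)}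
          = {(u, S) \<in> \<Omega> k. \<not> good p n r \<kappa> P (pick (2 ^ k) (2 ^ (t - k)) u S)}"
        by auto
      moreover have "real (card {..t}) / (99 * real d) = \<delta>" by (simp add: \<delta>_def add.commute)
      ultimately show ?thesis using bspec[OF P, of k] that by (simp only: atMost_iff)
    qed
    define a where "a j = npow p r (\<lambda>i. P (i, j))" for j
    define H where "H k = {j. j < 2 ^ t \<and> \<kappa> powr p * 2 ^ k < a j}" for k
    have prod_eq: "2 ^ k * 2 ^ (t - k) = (2 ^ t :: nat)" if "k \<le> t" for k
      using that by (simp add: power_add[symmetric])
    have H_card: "real (card (H k)) \<le> 4 * \<delta> * 2 ^ (t - k)" if "k \<le> t" for k
      using card_heavy_le[of "2 ^ (t - k)" "2 ^ k" n p \<delta> r \<kappa> P] bad[OF that] prod_eq[OF that] t p True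
      by (simp add: \<Omega>_def H_def a_def)
    have finH: "finite (H k)" for k by (simp add: H_def)
    \<comment> \<open>At scale \<open>t\<close> the blocks have length 1, so the count is at most
      \<open>4 * \<delta>\<close>, hence below 1. All columns are thus capped at
      \<open>\<kappa> powr p * 2 ^ t\<close>, as the dyadic decomposition requires.\<close>
    have "H t = {}"
    proof -
      have "real (card (H t)) < 1" using H_card[of t] True by simp
      then show ?thesis using finH by simp
    qed
    then have a_le: "a j \<le> \<kappa> powr p * 2 ^ t" if "j < 2 ^ t" for j
      using that by (force simp: H_def)
    have heavy: "a j \<le> \<kappa> powr p * (\<Sum>k<t. if j \<in> H k then 2 ^ (k + 1) else 0)" if j: "j \<in> H 0" for j
    proof -
      have j': "j < 2 ^ t" "\<kappa> powr p < a j" using j by (auto simp: H_def)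
      define x where "x = a j / \<kappa> powr p"
      have ax: "a j = \<kappa> powr p * x" using \<kappa> by (simp add: x_def)
      have "x \<le> 2 ^ t" "1 < x" "\<And>k. j \<in> H k \<longleftrightarrow> 2 ^ k < x"
        using a_le[OF j'(1)] j' \<kappa>
          mult_less_cancel_left_pos[of "\<kappa> powr p" 1 x]
        by (simp_all add: ax H_def mult_le_cancel_left_pos mult_less_cancel_left_pos)
      then show ?thesis using dyadic_layer_cake[of x t] by (simp add: ax mult_left_mono)
    qed
    have heavy_sum: "(\<Sum>j\<in>H 0. a j) \<le> \<kappa> powr p * (real t * (8 * \<delta>)) * 2 ^ t"
    proof -
      have "(\<Sum>j\<in>H 0. a j) \<le> (\<Sum>j\<in>H 0. \<kappa> powr p * (\<Sum>k<t. if j \<in> H k then 2 ^ (k + 1) else 0))"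
        by (intro sum_mono heavy)
      also have "\<dots> = \<kappa> powr p * (\<Sum>k<t. \<Sum>j\<in>H 0. if j \<in> H k then 2 ^ (k + 1) else 0)"
        by (subst sum.swap) (simp add: sum_distrib_left)
      also have "\<dots> \<le> \<kappa> powr p * (\<Sum>k<t. 8 * \<delta> * 2 ^ t)"
      proof (intro mult_left_mono sum_mono)
        fix k assume "k \<in> {..<t}"
        then have k: "k \<le> t" by simp
        have "(\<Sum>j\<in>H 0. if j \<in> H k then 2 ^ (k + 1) else 0) = real (card (H 0 \<inter> H k)) * 2 ^ (k + 1)"
          using finH by (simp add: sum.If_cases)
        also have "\<dots> \<le> real (card (H k)) * 2 ^ (k + 1)"
          using finH by (intro mult_right_mono) (auto intro: card_mono)
        also have "\<dots> \<le> 4 * \<delta> * 2 ^ (t - k) * 2 ^ (k + 1)"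
          using H_card[OF k] by (intro mult_right_mono) auto
        \<comment> \<open>The bound on the count halves as the size doubles, so all scales get the
          same bound.\<close>
        also have "\<dots> = 8 * \<delta> * (2 ^ (t - k) * 2 ^ k)" by simp
        also have "\<dots> = 8 * \<delta> * 2 ^ t" using k by (simp add: power_add[symmetric])
        finally show "(\<Sum>j\<in>H 0. if j \<in> H k then 2 ^ (k + 1) else 0) \<le> 8 * \<delta> * 2 ^ t" .
      qed auto
      finally show ?thesis by (simp add: mult_ac)
    qed
    define M :: nat where "M = 2 ^ t"
    define y where "y S = npow p r (\<lambda>i. \<Sum>g<M. sgns S g * P (i, g))" for S
    \<comment> \<open>With blocks of length 1 the zero offset is the only one, so scale
      \<open>t\<close> gives a uniform sign vector on the first \<open>M\<close> coordinates. The
      lower bound of the embedding is applied to this vector.\<close>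
    define u0 :: "nat \<Rightarrow> nat" where "u0 = (\<lambda>g\<in>{..<M}. 0)"
    define N where "N = {S \<in> Pow {..<M}. \<not> good p n r \<kappa> P (pick M 1 u0 S)}"
    have u0: "u0 \<in> {..<M} \<rightarrow>\<^sub>E {..<1}" by (auto simp: u0_def)
    have Mn: "M * 1 \<le> n" using t by (simp add: M_def)
    have "{..<M} \<rightarrow>\<^sub>E {..<1 :: nat} = (\<Pi>\<^sub>E g\<in>{..<M}. {u0 g})"
      by (intro PiE_cong) (auto simp: u0_def)
    also have "\<dots> = {u0}"
      unfolding u0_def by (rule PiE_singleton) (rule restrict_extensional)
    finally have \<Omega>t: "\<Omega> t = {u0} \<times> Pow {..<M}" by (simp add: \<Omega>_def M_def)
    have "{(u, S) \<in> \<Omega> t. \<not> good p n r \<kappa> P (pick (2 ^ t) (2 ^ (t - t)) u S)} = {u0} \<times> N"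
      unfolding \<Omega>t by (auto simp: N_def M_def)
    with bad[of t] have N_card: "real (card N) \<le> \<delta> * 2 ^ M"
      by (simp add: \<Omega>t card_cartesian_product card_Pow)
    have y_ge: "real M \<le> y S" if "S \<in> Pow {..<M} - N" for S
    proof -
      have "mat_vec n P (pick M 1 u0 S) = (\<lambda>i. \<Sum>g<M. sgns S g * P (i, g))"
        using mat_vec_pick[OF Mn u0] by (simp add: u0_def fun_eq_iff)
      moreover have "npow p n (pick M 1 u0 S) = real M" by (rule npow_pick[OF Mn u0])
      ultimately show ?thesis using that by (auto simp: N_def good_def y_def)
    qed
    have "7 / 8 * 2 ^ M \<le> real (card (Pow {..<M} - N))"
    proof -
      have "N \<subseteq> Pow {..<M}" by (auto simp: N_def)
      then have "real (card (Pow {..<M} - N)) = 2 ^ M - real (card N)"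
        using card_mono[of "Pow {..<M}" N] finite_subset[of N "Pow {..<M}"]
        by (simp add: card_Diff_subset card_Pow of_nat_diff)
      moreover have "\<delta> * 2 ^ M \<le> 1 / 8 * 2 ^ M" using True by (intro mult_right_mono) auto
      ultimately show ?thesis using N_card by linarith
    qed
    then have "7 / 8 * 2 ^ M * real M \<le> real (card (Pow {..<M} - N)) * real M"
      by (intro mult_right_mono) auto
    also have "\<dots> \<le> (\<Sum>S\<in>Pow {..<M} - N. y S)"
      by (intro sum_bounded_below y_ge)
    also have "\<dots> \<le> (\<Sum>S\<in>Pow {..<M}. y S)"
      by (intro sum_mono2) (auto simp: y_def npow_nonneg)
    also have "\<dots> \<le> 2 ^ card {..<M} * ((\<Sum>j\<in>H 0. npow p r (\<lambda>i. P (i, j)))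
        + real r powr (1 - p / 2) * real (card {..<M}) powr (p / 2) * \<kappa> powr p)"
      unfolding y_def using p
      by (intro sum_sgns_npow_le) (auto simp: H_def a_def M_def)
    also have "\<dots> = 2 ^ M * ((\<Sum>j\<in>H 0. a j) + real r powr (1 - p / 2) * real M powr (p / 2) * \<kappa> powr p)"
      by (simp add: a_def)
    also have "\<dots> \<le> 2 ^ M * (\<kappa> powr p * (real t * (8 * \<delta>)) * real M
        + real r powr (1 - p / 2) * real M powr (p / 2) * \<kappa> powr p)"
      using heavy_sum by (intro mult_left_mono add_right_mono) (auto simp: M_def)
    also have "real M powr (p / 2) = real M / real M powr (1 - p / 2)"
      by (subst powr_diff) (auto simp: M_def)
    also have "2 ^ M * (\<kappa> powr p * (real t * (8 * \<delta>)) * real M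
        + real r powr (1 - p / 2) * (real M / real M powr (1 - p / 2)) * \<kappa> powr p)
        = (\<kappa> powr p * (real t * (8 * \<delta>) + (real r / real M) powr (1 - p / 2))) * (2 ^ M * real M)"
      by (simp add: powr_divide algebra_simps)
    finally have "7 / 8 * (2 ^ M * real M) \<le> \<dots>" by (simp add: mult.assoc)
    then have "7 / 8 \<le> \<kappa> powr p * (real t * (8 * \<delta>) + (real r / real M) powr (1 - p / 2))"
      by (rule mult_right_le_imp_le) (simp add: M_def)
    also have "\<dots> \<le> \<kappa> powr p * ((real t + 1)\<^sup>2 / real d + (real r / 2 ^ t) powr (1 - p / 2))"
    proof (intro mult_left_mono add_mono)
      have "real t * (8 * \<delta>) = 8 / 99 * (real t * (real t + 1) / real d)" by (simp add: \<delta>_def)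
      also have "\<dots> \<le> 1 * (real t * (real t + 1) / real d)" by (intro mult_right_mono) auto
      also have "\<dots> \<le> (real t + 1)\<^sup>2 / real d"
        unfolding power2_eq_square mult_1 by (intro divide_right_mono mult_right_mono) auto
      finally show "real t * (8 * \<delta>) \<le> (real t + 1)\<^sup>2 / real d" .
    qed (auto simp: M_def)
    finally show ?thesis by linarith
  qed
qed

section \<open>Choice of the dyadic size and conclusion\<close>

text \<open>\<open>K\<close> is chosen so that \<open>(r / r powr K) powr (1 - p / 2) = 1 / r\<close>, which is at most \<open>1 / d\<close>.\<close>

lemma dyadic_scale_exists:
  fixes p :: real
  assumes p: "1 \<le> p" "p < 2" and "1 \<le> d" "d \<le> r" "2 \<le> r" "1 \<le> n"
  defines "K \<equiv> 1 + 2 / (2 - p)"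
  shows "\<exists>t. 2 ^ t \<le> n \<and> (real t + 1)\<^sup>2 / real d + (real r / 2 ^ t) powr (1 - p / 2)
     \<le> (((K + 2)\<^sup>2 + 1) / (ln 2)\<^sup>2 + 2) * ((ln (real r))\<^sup>2 / real d + (real r / real n) powr (1 - p / 2))"
proof -
  define l where "l = log 2 (real r)"
  have l: "1 \<le> l" using assms by (simp add: l_def le_log_iff)
  have K: "0 \<le> K" using p by (simp add: K_def)
  \<comment> \<open>Rounding up makes \<open>2 ^ T\<close> at least \<open>r powr K\<close>; below,
    \<open>2 ^ N\<close> is the largest power of two not exceeding \<open>n\<close>.\<close>
  define T where "T = nat \<lceil>K * l\<rceil>"
  obtain N where N: "2 ^ N \<le> n" "n < 2 ^ (N + 1)"
    using ex_power_ivl1[of 2 n] assms by auto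
  define t where "t = min T N"
  let ?C = "((K + 2)\<^sup>2 + 1) / (ln 2)\<^sup>2"
  let ?Y = "(real r / real n) powr (1 - p / 2)"
  have T: "K * l \<le> real T" "real T \<le> K * l + 1"
    using K l by (auto simp: T_def)
  have "real t + 1 \<le> K * l + 2" using T by (simp add: t_def)
  also have "\<dots> \<le> (K + 2) * l" using l by (simp add: algebra_simps)
  finally have "(real t + 1)\<^sup>2 \<le> ((K + 2) * l)\<^sup>2" by (intro power_mono) auto
  moreover have "1 \<le> l\<^sup>2" using l by simp
  \<comment> \<open>The extra 1 is kept to pay for the \<open>1 / real d\<close> that arises when
    \<open>T \<le> N\<close>.\<close>
  ultimately have "(real t + 1)\<^sup>2 + 1 \<le> ((K + 2)\<^sup>2 + 1) * l\<^sup>2"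
    unfolding power_mult_distrib distrib_right[of "(K + 2)\<^sup>2"] by linarith
  also have "\<dots> = ?C * (ln (real r))\<^sup>2"
    by (simp add: l_def log_def power_divide)
  finally have "((real t + 1)\<^sup>2 + 1) / real d \<le> ?C * (ln (real r))\<^sup>2 / real d"
    by (intro divide_right_mono) auto
  then have t1: "(real t + 1)\<^sup>2 / real d + 1 / real d \<le> ?C * ((ln (real r))\<^sup>2 / real d)"
    by (simp add: add_divide_distrib)
  have t2: "(real r / 2 ^ t) powr (1 - p / 2) \<le> 1 / real d + 2 * ?Y"
  proof (cases "T \<le> N")
    \<comment> \<open>By \<open>d \<le> r\<close> and the choice of \<open>K\<close>, the ratio
      \<open>r / 2 ^ t\<close> is at most \<open>d powr (- (2 / (2 - p)))\<close>, whose power with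
      exponent \<open>1 - p / 2\<close> is \<open>1 / d\<close>.\<close>
    case True
    have "real d powr (2 / (2 - p)) \<le> real r powr (2 / (2 - p))"
      using assms by (intro powr_mono2) auto
    then have "real r * real d powr (2 / (2 - p)) \<le> real r * real r powr (2 / (2 - p))"
      by (intro mult_left_mono) auto
    also have "\<dots> = real r powr K" using assms by (simp add: K_def powr_add)
    also have "\<dots> = 2 powr (K * l)"
      using assms by (simp add: l_def powr_def log_def)
    also have "\<dots> \<le> 2 powr real T" using T by simp
    also have "\<dots> = 2 ^ t" using True by (simp add: powr_realpow t_def)
    finally have "real r / 2 ^ t \<le> real d powr (- (2 / (2 - p)))"
      using assms by (simp add: powr_minus field_simps)
    then have "(real r / 2 ^ t) powr (1 - p / 2) \<le> (real d powr (- (2 / (2 - p)))) powr (1 - p / 2)"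
      using p by (intro powr_mono2) auto
    also have "\<dots> = real d powr (- 1)"
      using p by (simp add: powr_powr field_simps)
    also have "\<dots> = 1 / real d" using assms by (simp add: powr_minus_divide)
    finally show ?thesis using powr_ge_zero[of "real r / real n" "1 - p / 2"] by linarith
  next
    \<comment> \<open>Now \<open>2 ^ t\<close> is within a factor 2 of \<open>n\<close>.\<close>
    case False
    then have "t = N" by (simp add: t_def)
    moreover have "real n \<le> 2 * 2 ^ N"
      using N(2) by (simp add: of_nat_less_iff[symmetric, where 'a = real] del: of_nat_less_iff)
    ultimately have "real r / 2 ^ t \<le> 2 * (real r / real n)"
      using assms by (simp add: field_simps mult_left_mono)
    then have "(real r / 2 ^ t) powr (1 - p / 2) \<le> (2 * (real r / real n)) powr (1 - p / 2)"
      using p by (intro powr_mono2) auto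
    also have "\<dots> = 2 powr (1 - p / 2) * ?Y" by (rule powr_mult)
    also have "\<dots> \<le> 2 powr 1 * ?Y"
      using p by (intro mult_right_mono powr_mono) auto
    finally have "(real r / 2 ^ t) powr (1 - p / 2) \<le> 2 * ?Y" by simp
    moreover have "0 \<le> 1 / real d" by simp
    ultimately show ?thesis by linarith
  qed
  have "(real t + 1)\<^sup>2 / real d + (real r / 2 ^ t) powr (1 - p / 2)
      \<le> ?C * ((ln (real r))\<^sup>2 / real d) + 2 * ?Y"
    using t1 t2 by linarith
  also have "\<dots> \<le> (?C + 2) * ((ln (real r))\<^sup>2 / real d + ?Y)"
  proof -
    have "0 \<le> ?C * ?Y" "0 \<le> (ln (real r))\<^sup>2 / real d" by auto
    then show ?thesis unfolding distrib_left distrib_right by linarith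
  qed
  finally have "(real t + 1)\<^sup>2 / real d + (real r / 2 ^ t) powr (1 - p / 2)
      \<le> (?C + 2) * ((ln (real r))\<^sup>2 / real d + ?Y)" .
  moreover have "2 ^ t \<le> n"
  proof -
    have "(2 :: nat) ^ t \<le> 2 ^ N" by (rule power_increasing) (auto simp: t_def)
    with N(1) show ?thesis by (rule order_trans[rotated])
  qed
  ultimately show ?thesis by blast
qed

theorem theorem1:
  fixes p :: real
  assumes "1 \<le> p" and "p < 2"
  shows "\<exists>c > 0. \<forall>n d r :: nat. \<forall>\<kappa> :: real. \<forall>D.
           1 \<le> d \<longrightarrow> d \<le> n \<longrightarrow> 2 \<le> r \<longrightarrow> lp_OSE p n d r \<kappa> D \<longrightarrow>
           \<kappa> \<ge> c / ((1 / real d) powr (1 / p) * ln (real r) powr (2 / p)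
                    + (real r / real n) powr (1 / p - 1 / 2))"
proof -
  define K where "K = 1 + 2 / (2 - p)"
  define C where "C = ((K + 2)\<^sup>2 + 1) / (ln 2)\<^sup>2 + 2"
  have C: "C > 0" unfolding C_def by (intro add_nonneg_pos divide_nonneg_nonneg) auto
  \<comment> \<open>This is what remains when
    \<open>3 / 4 \<le> 2 * C * (\<kappa> * (X + Y)) powr p\<close> is solved for
    \<open>\<kappa> * (X + Y)\<close>.\<close>
  define c where "c = (3 / (8 * C)) powr (1 / p)"
  have "c > 0" using C by (simp add: c_def)
  moreover have "\<kappa> \<ge> c / ((1 / real d) powr (1 / p) * ln (real r) powr (2 / p)
                    + (real r / real n) powr (1 / p - 1 / 2))"
    if d: "1 \<le> d" and dn: "d \<le> n" and r: "2 \<le> r" and ose: "lp_OSE p n d r \<kappa> D" for n d r \<kappa> D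
  proof -
    define X where "X = (1 / real d) powr (1 / p) * ln (real r) powr (2 / p)"
    define Y where "Y = (real r / real n) powr (1 / p - 1 / 2)"
    have \<kappa>: "1 \<le> \<kappa>" using ose by (simp add: lp_OSE_def)
    have XY: "0 \<le> X" "0 < Y" using d dn r by (auto simp: X_def Y_def)
    have "X powr p = (1 / real d) * ln (real r) powr 2"
      using assms d by (simp add: X_def powr_mult powr_powr)
    then have Xp: "X powr p = (ln (real r))\<^sup>2 / real d"
      using r by (simp add: powr_numeral)
    have "(1 / p - 1 / 2) * p = 1 - p / 2" using assms by (simp add: field_simps)
    then have Yp: "Y powr p = (real r / real n) powr (1 - p / 2)"
      by (simp add: Y_def powr_powr)
    obtain t where t: "2 ^ t \<le> n" "(real t + 1)\<^sup>2 / real d + (real r / 2 ^ t) powr (1 - p / 2)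
        \<le> C * (X powr p + Y powr p)"
      using dyadic_scale_exists[OF assms d lp_OSE_dim_le[OF ose assms(1) dn] r, of n] d dn
      unfolding Xp Yp C_def K_def by auto
    have "3 / 4 \<le> \<kappa> powr p * ((real t + 1)\<^sup>2 / real d + (real r / 2 ^ t) powr (1 - p / 2))"
      by (rule lp_OSE_dyadic_bound[OF ose assms d t(1)])
    also have "\<dots> \<le> \<kappa> powr p * (C * (X powr p + Y powr p))"
      using t(2) by (intro mult_left_mono) auto
    \<comment> \<open>Each of \<open>X\<close> and \<open>Y\<close> is at most \<open>X + Y\<close>,
      so merging the two powers costs only a factor 2.\<close>
    also have "\<dots> \<le> \<kappa> powr p * (C * ((X + Y) powr p + (X + Y) powr p))"
      using XY C assms by (intro mult_left_mono add_mono powr_mono2) auto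
    also have "\<dots> = 2 * C * (\<kappa> * (X + Y)) powr p"
      using \<kappa> XY by (simp add: powr_mult)
    finally have "3 / (8 * C) \<le> (\<kappa> * (X + Y)) powr p"
      using C by (simp add: field_simps)
    then have "c \<le> ((\<kappa> * (X + Y)) powr p) powr (1 / p)"
      unfolding c_def using C assms by (intro powr_mono2) auto
    also have "\<dots> = \<kappa> * (X + Y)"
      using assms \<kappa> XY by (simp add: powr_powr)
    finally show ?thesis
      using XY unfolding X_def[symmetric] Y_def[symmetric] by (simp add: pos_divide_le_eq)
  qed
  ultimately show ?thesis by blast
qed

end
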